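(* Let $1\le p\le2$ (or any $p\ge1$ if $\mathcal{I}$ is finite) and $r>0$, with $r\ge1/4$ if $p=1$. Let $T:\ell_2(\mathcal{I})\to\ell_2(\mathcal{K})$ be a bounded linear operator with $\|T\|<1$ ($\mathcal{I},\mathcal{K}$ countable), $g\in\ell_2(\mathcal{K})$, and $\mathcal{J}^p_r(u)=\|Tu-g\|^2_{\ell_2(\mathcal{K})}+\sum_{i\in\mathcal{I}}\min\{|u_i|^p,r^p\}$. Then any global minimizer $u^*\in\ell_2(\mathcal{I})$ of $\mathcal{J}^p_r$ satisfies the following fixed point condition: 1. $|u^*_i|\ge\lambda'(r,p)$ if $|u^*_i|>r$; 2. for $p>1$, $|u^*_i|\le F_p^{-1}(\lambda'(r,p))$ if $|u^*_i|\le r$; 3. (a) if $p>1$: $$[T^*(g-Tu^* )]_i=\begin{cases} 0, & \text{if }|u^*_i|\ge\lambda'(r,p), \\ F_p(u^*_i)-u^*_i, & \text{if }|u^*_i|\le\lambda'(r,p)-\delta(r,p); \end{cases}$$ (b) if $p=1$ and $r\ge1/4$: $$\begin{cases} [T^*(g-Tu^* )]_i\in[-1/2,1/2], & |u^*_i|\le1/2, \\ [T^*(g-Tu^* )]_i=\tfrac12\operatorname{sgn}u^*_i, & 1/2<|u^*_i|\le r-1/4, \\ [T^*(g-Tu^* )]_i=0, & |u^*_i|>r+1/4. \end{cases}$$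
   Context: For $p>1$: $F_p(t)=t+\frac p2\operatorname{sgn}(t)|t|^{p-1}$, with inverse $F_p^{-1}:\mathbb{R}\to\mathbb{R}$; $\lambda'=\lambda'(r,p)\in(r,r+\frac p2r^{p-1})$ is the unique positive value with $(F_p^{-1}(\lambda')-\lambda')^2+|F_p^{-1}(\lambda')|^p=r^p$; and $\delta(r,p)=\lambda'-F_p^{-1}(\lambda')>0$. For $p=1$, $r\ge1/4$: $\lambda'(r,1)=r+1/4$. *)

theory Defs
  imports "HOL-Analysis.Analysis"
begin

typedef 'i ell2 = "{u :: 'i \<Rightarrow> real. (\<lambda>i. (u i)\<^sup>2) summable_on UNIV}"
  morphisms ell2_nth Abs_ell2
  by (rule exI[of _ "\<lambda>_. 0"]) simp

setup_lifting type_definition_ell2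

lemma ell2_eqI: "(\<And>i. ell2_nth u i = ell2_nth v i) \<Longrightarrow> u = v"
  by (metis ell2_nth_inject ext)

lemma square_summable_mult:
  fixes u v :: "'i \<Rightarrow> real"
  assumes "(\<lambda>i. (u i)\<^sup>2) summable_on UNIV" "(\<lambda>i. (v i)\<^sup>2) summable_on UNIV"
  shows "(\<lambda>i. u i * v i) summable_on UNIV"
proof -
  have "(\<lambda>i. norm (u i * v i)) summable_on UNIV"
    by (rule abs_summable_product) (use assms in \<open>simp_all add: power2_eq_square\<close>)
  then show ?thesis
    by (rule abs_summable_summable)
qed

lemma square_summable_add:
  fixes u v :: "'i \<Rightarrow> real"
  assumes "(\<lambda>i. (u i)\<^sup>2) summable_on UNIV" "(\<lambda>i. (v i)\<^sup>2) summable_on UNIV"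
  shows "(\<lambda>i. (u i + v i)\<^sup>2) summable_on UNIV"
proof -
  have "(\<lambda>i. ((u i)\<^sup>2 + (v i)\<^sup>2) + 2 * (u i * v i)) summable_on UNIV"
    by (intro summable_on_add summable_on_cmult_right square_summable_mult assms)
  then show ?thesis
    by (simp add: power2_sum mult.assoc)
qed

lemma square_summable_scale:
  fixes u :: "'i \<Rightarrow> real"
  assumes "(\<lambda>i. (u i)\<^sup>2) summable_on UNIV"
  shows "(\<lambda>i. (c * u i)\<^sup>2) summable_on UNIV"
  by (simp add: power_mult_distrib summable_on_cmult_right assms)

lemma ell2_summable: "(\<lambda>i. (ell2_nth u i)\<^sup>2) summable_on UNIV"
  using ell2_nth[of u] by simp

instantiation ell2 :: (type) real_vector
begin

lift_definition zero_ell2 :: "'a ell2" is "\<lambda>_. 0"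
  by simp

lift_definition plus_ell2 :: "'a ell2 \<Rightarrow> 'a ell2 \<Rightarrow> 'a ell2" is "\<lambda>u v i. u i + v i"
  by (rule square_summable_add)

lift_definition uminus_ell2 :: "'a ell2 \<Rightarrow> 'a ell2" is "\<lambda>u i. - u i"
  by simp

lift_definition scaleR_ell2 :: "real \<Rightarrow> 'a ell2 \<Rightarrow> 'a ell2" is "\<lambda>c u i. c * u i"
  by (rule square_summable_scale)

definition minus_ell2 :: "'a ell2 \<Rightarrow> 'a ell2 \<Rightarrow> 'a ell2"
  where "minus_ell2 u v = u + - v"

instance
  by standard
    (rule ell2_eqI, simp add: minus_ell2_def plus_ell2.rep_eq zero_ell2.rep_eq
      uminus_ell2.rep_eq scaleR_ell2.rep_eq algebra_simps)+

end

instantiation ell2 :: (type) real_inner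
begin

definition inner_ell2 :: "'a ell2 \<Rightarrow> 'a ell2 \<Rightarrow> real"
  where "inner_ell2 u v = (\<Sum>\<^sub>\<infinity>i. ell2_nth u i * ell2_nth v i)"

definition norm_ell2 :: "'a ell2 \<Rightarrow> real"
  where "norm_ell2 u = sqrt (\<Sum>\<^sub>\<infinity>i. (ell2_nth u i)\<^sup>2)"

definition dist_ell2 :: "'a ell2 \<Rightarrow> 'a ell2 \<Rightarrow> real"
  where "dist_ell2 u v = norm (u - v)"

definition sgn_ell2 :: "'a ell2 \<Rightarrow> 'a ell2"
  where "sgn_ell2 u = u /\<^sub>R norm u"

definition uniformity_ell2 :: "('a ell2 \<times> 'a ell2) filter"
  where "uniformity_ell2 = (INF e\<in>{0<..}. principal {(u, v). dist u v < e})"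

definition open_ell2 :: "'a ell2 set \<Rightarrow> bool"
  where "open_ell2 U \<longleftrightarrow> (\<forall>u\<in>U. eventually (\<lambda>(u', v). u' = u \<longrightarrow> v \<in> U) uniformity)"

instance
proof
  fix u v w :: "'a ell2" and c :: real and U :: "'a ell2 set"
  have mult: "(\<lambda>i. ell2_nth a i * ell2_nth b i) summable_on UNIV" for a b :: "'a ell2"
    by (intro square_summable_mult ell2_summable)
  show "dist u v = norm (u - v)"
    by (rule dist_ell2_def)
  show "sgn u = u /\<^sub>R norm u"
    by (rule sgn_ell2_def)
  show "uniformity = (INF e\<in>{0<..}. principal {(u :: 'a ell2, v). dist u v < e})"
    by (rule uniformity_ell2_def)
  show "open U \<longleftrightarrow> (\<forall>u\<in>U. \<forall>\<^sub>F (u', v) in uniformity. u' = u \<longrightarrow> v \<in> U)"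
    by (rule open_ell2_def)
  show "inner u v = inner v u"
    by (simp add: inner_ell2_def mult.commute)
  show "inner (u + v) w = inner u w + inner v w"
    by (simp add: inner_ell2_def plus_ell2.rep_eq distrib_right infsum_add mult)
  show "inner (c *\<^sub>R u) v = c * inner u v"
    by (simp add: inner_ell2_def scaleR_ell2.rep_eq mult.assoc infsum_cmult_right')
  show "0 \<le> inner u u"
    by (simp add: inner_ell2_def infsum_nonneg)
  show "inner u u = 0 \<longleftrightarrow> u = 0"
  proof
    assume "inner u u = 0"
    then have "ell2_nth u i * ell2_nth u i = 0" for i
      using nonneg_infsum_le_0D[OF _ mult[of u u], of i] by (simp add: inner_ell2_def)
    then show "u = 0"
      by (intro ell2_eqI) (simp add: zero_ell2.rep_eq)
  qed (simp add: inner_ell2_def zero_ell2.rep_eq)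
  show "norm u = sqrt (inner u u)"
    by (simp add: norm_ell2_def inner_ell2_def power2_eq_square)
qed

end

definition F_thr :: "real \<Rightarrow> real \<Rightarrow> real"
  where "F_thr p t = t + p / 2 * sgn t * \<bar>t\<bar> powr (p - 1)"

text \<open>For \<open>p > 1\<close> the map \<open>F_thr p\<close> is a bijection of the reals, so \<open>inv\<close> is its genuine inverse.\<close>

definition F_inv :: "real \<Rightarrow> real \<Rightarrow> real"
  where "F_inv p = inv (F_thr p)"

text \<open>For \<open>p > 1\<close> exactly one positive \<open>l\<close> satisfies the equation below, and it lies in the open
  interval from \<open>r\<close> to \<open>r + p / 2 * r powr (p - 1)\<close>. For \<open>p = 1\<close> the value is used with
  \<open>r \<ge> 1 / 4\<close>; for \<open>p < 1\<close> it has no meaning.\<close>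

definition lambda' :: "real \<Rightarrow> real \<Rightarrow> real"
  where "lambda' r p =
    (if p = 1 then r + 1 / 4
     else (THE l. 0 < l \<and> (F_inv p l - l)\<^sup>2 + \<bar>F_inv p l\<bar> powr p = r powr p))"

definition delta :: "real \<Rightarrow> real \<Rightarrow> real"
  where "delta r p = lambda' r p - F_inv p (lambda' r p)"

text \<open>The functional takes values in \<open>[0, \<infinity>]\<close>: for \<open>p < 2\<close> and infinite index type the
  sum can diverge on \<open>ell2\<close>.\<close>

definition J_fun ::
    "('i ell2 \<Rightarrow> 'k ell2) \<Rightarrow> 'k ell2 \<Rightarrow> real \<Rightarrow> real \<Rightarrow> 'i ell2 \<Rightarrow> ennreal"
  where "J_fun T g p r u =
    ennreal ((norm (T u - g))\<^sup>2)
      + (\<Sum>\<^sub>\<infinity>i. ennreal (min (\<bar>ell2_nth u i\<bar> powr p) (r powr p)))"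

end

theory Submission
  imports Defs
begin

text \<open>Changing only the coordinate \<open>u\<^sub>i\<close> of a minimizer by \<open>h\<close> changes the quadratic term by
  \<open>h\<^sup>2 * (norm (T e\<^sub>i))\<^sup>2 - 2 * h * w\<close> with \<open>w = [T\<^sup>* (g - T u)]\<^sub>i\<close>. As \<open>norm (T e\<^sub>i) \<le> 1\<close>, \<open>u\<^sub>i\<close>
  minimizes the scalar function \<open>(t - (u\<^sub>i + w))\<^sup>2 + min (\<bar>t\<bar> powr p) (r powr p)\<close>. Above the
  threshold the penalty cannot increase, which forces \<open>w = 0\<close>; below it \<open>u\<^sub>i\<close> also minimizes the
  untruncated function, whose stationarity reads \<open>u\<^sub>i + w = F_thr p u\<^sub>i\<close> for \<open>p > 1\<close>. For \<open>p > 1\<close>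
  the minimum of \<open>(t - l)\<^sup>2 + \<bar>t\<bar> powr p\<close> is strictly increasing in \<open>l > 0\<close> and equals \<open>r powr p\<close> at
  \<open>l = lambda' r p\<close>; comparing it with \<open>r powr p\<close> gives the gap in the values of \<open>\<bar>u\<^sub>i\<bar>\<close>.\<close>

section \<open>The adjoint of a bounded operator on \<open>ell2\<close>\<close>

lift_definition ell2_unit :: "'i \<Rightarrow> 'i ell2" is "\<lambda>i j. if j = i then 1 else 0"
proof -
  fix i :: 'i
  have "((\<lambda>j. (if j = i then 1 else 0 :: real)\<^sup>2) has_sum 1) UNIV"
    by (rule has_sum_finite_neutralI[of "{i}"]) auto
  then show "(\<lambda>j. (if j = i then 1 else 0 :: real)\<^sup>2) summable_on UNIV"
    by (rule has_sum_imp_summable)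
qed

lemma inner_ell2_unit [simp]: "inner (ell2_unit i) u = ell2_nth u i"
proof -
  have "((\<lambda>j. ell2_nth (ell2_unit i) j * ell2_nth u j) has_sum ell2_nth u i) UNIV"
    by (rule has_sum_finite_neutralI[of "{i}"]) (auto simp: ell2_unit.rep_eq)
  then show ?thesis
    by (simp add: inner_ell2_def infsumI)
qed

lemma norm_ell2_unit [simp]: "norm (ell2_unit i) = 1"
  by (simp add: norm_eq_sqrt_inner ell2_unit.rep_eq)

lemma ell2_nth_sum: "ell2_nth (\<Sum>i\<in>F. f i) j = (\<Sum>i\<in>F. ell2_nth (f i) j)"
  by (induction F rule: infinite_finite_induct) (auto simp: zero_ell2.rep_eq plus_ell2.rep_eq)

lemma ell2_nth_truncation:
  assumes "finite F"
  shows "ell2_nth (\<Sum>i\<in>F. c i *\<^sub>R ell2_unit i) j = (if j \<in> F then c j else 0)"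
proof -
  have "ell2_nth (\<Sum>i\<in>F. c i *\<^sub>R ell2_unit i) j = (\<Sum>i\<in>F. if j = i then c i else 0)"
    by (auto simp: ell2_nth_sum scaleR_ell2.rep_eq ell2_unit.rep_eq intro!: sum.cong)
  then show ?thesis
    using assms by simp
qed

lemma norm_ell2_truncation:
  assumes "finite F"
  shows "(norm (\<Sum>i\<in>F. c i *\<^sub>R ell2_unit i))\<^sup>2 = (\<Sum>i\<in>F. (c i)\<^sup>2)"
proof -
  have "(norm (\<Sum>i\<in>F. c i *\<^sub>R ell2_unit i))\<^sup>2
      = (\<Sum>j\<in>F. c j * ell2_nth (\<Sum>i\<in>F. c i *\<^sub>R ell2_unit i) j)"
    unfolding power2_norm_eq_inner by (subst inner_sum_left) simp
  also have "\<dots> = (\<Sum>j\<in>F. (c j)\<^sup>2)"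
    using assms by (simp add: ell2_nth_truncation power2_eq_square)
  finally show ?thesis .
qed

text \<open>The squared distance from a finite partial sum to \<open>u\<close> is the remaining tail
  of the sum of squares, which tends to 0.\<close>

lemma ell2_has_sum: "((\<lambda>i. ell2_nth u i *\<^sub>R ell2_unit i) has_sum u) UNIV"
proof -
  let ?S = "\<lambda>F. \<Sum>i\<in>F. ell2_nth u i *\<^sub>R ell2_unit i"
  have sq: "((\<lambda>i. (ell2_nth u i)\<^sup>2) has_sum inner u u) UNIV"
    using has_sum_infsum[OF ell2_summable[of u]] by (simp add: inner_ell2_def power2_eq_square)
  have dist: "dist (?S F) u = sqrt (inner u u - (\<Sum>i\<in>F. (ell2_nth u i)\<^sup>2))" if "finite F" for F
  proof -
    have "inner (?S F) u = (\<Sum>i\<in>F. (ell2_nth u i)\<^sup>2)"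
      by (simp add: inner_sum_left power2_eq_square)
    moreover have "inner (?S F) (?S F) = (\<Sum>i\<in>F. (ell2_nth u i)\<^sup>2)"
      using norm_ell2_truncation[OF that] by (simp add: power2_norm_eq_inner)
    ultimately have "inner (?S F - u) (?S F - u) = inner u u - (\<Sum>i\<in>F. (ell2_nth u i)\<^sup>2)"
      by (simp add: inner_diff inner_commute)
    then show ?thesis
      by (simp add: dist_norm norm_eq_sqrt_inner)
  qed
  have "((\<lambda>F. sqrt (inner u u - (\<Sum>i\<in>F. (ell2_nth u i)\<^sup>2))) \<longlongrightarrow> sqrt (inner u u - inner u u))
      (finite_subsets_at_top UNIV)"
    using sq unfolding has_sum_def by (intro tendsto_intros)
  then have "((\<lambda>F. dist (?S F) u) \<longlongrightarrow> 0) (finite_subsets_at_top UNIV)"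
    by (auto simp: dist elim!: Lim_transform_eventually intro!: eventually_finite_subsets_at_top_weakI)
  then show ?thesis
    unfolding has_sum_def by (rule tendsto_dist_iff[THEN iffD2])
qed

text \<open>The candidate coefficients \<open>inner (T (ell2_unit i)) y\<close> are square summable because testing
  \<open>T\<close> on their finite truncations bounds the partial sums by \<open>(onorm T * norm y)\<^sup>2\<close>; this avoids
  the Riesz theorem and hence completeness of \<open>ell2\<close>.\<close>

lemma ell2_adjoint_exists:
  fixes T :: "'i ell2 \<Rightarrow> 'b::real_inner"
  assumes T: "bounded_linear T"
  shows "\<exists>c. \<forall>x. inner (T x) y = inner x c"
proof -
  interpret T: bounded_linear T by fact
  define c where "c i = inner (T (ell2_unit i)) y" for i
  define K where "K = onorm T * norm y"
  have bound: "(\<Sum>i\<in>F. (c i)\<^sup>2) \<le> K\<^sup>2" if "finite F" for F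
  proof -
    define x where "x = (\<Sum>i\<in>F. c i *\<^sub>R ell2_unit i)"
    have "(norm x)\<^sup>2 = inner (T x) y"
      unfolding x_def norm_ell2_truncation[OF that]
      by (simp add: T.sum T.scaleR inner_sum_left c_def power2_eq_square)
    also have "\<dots> \<le> norm (T x) * norm y"
      by (rule norm_cauchy_schwarz)
    also have "\<dots> \<le> K * norm x"
      using mult_right_mono[OF onorm[OF T, of x], of "norm y"] by (simp add: K_def mult_ac)
    finally have "norm x * norm x \<le> K * norm x"
      by (simp add: power2_eq_square)
    then have "norm x \<le> K"
      using onorm_pos_le[OF T] by (cases "norm x = 0") (auto simp: K_def)
    then show ?thesis
      by (metis norm_ell2_truncation[OF that] norm_ge_zero power_mono x_def)
  qed
  have "(\<lambda>i. (c i)\<^sup>2) summable_on UNIV"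
    by (rule nonneg_bdd_above_summable_on) (auto intro!: bdd_aboveI2[where M = "K\<^sup>2"] bound)
  then have nth: "ell2_nth (Abs_ell2 c) = c"
    by (simp add: Abs_ell2_inverse)
  have "inner (T x) y = inner x (Abs_ell2 c)" for x
  proof -
    have "((\<lambda>i. inner (T (ell2_nth x i *\<^sub>R ell2_unit i)) y) has_sum inner (T x) y) UNIV"
      by (rule has_sum_bounded_linear[OF _ ell2_has_sum])
        (rule bounded_linear_compose[OF bounded_linear_inner_left T])
    then show ?thesis
      by (simp add: inner_ell2_def[of x] nth c_def T.scaleR infsumI)
  qed
  then show ?thesis by blast
qed

lemma ell2_nth_adjoint:
  fixes T :: "'i ell2 \<Rightarrow> 'b::real_inner"
  assumes "bounded_linear T"
  shows "ell2_nth (adjoint T y) i = inner (T (ell2_unit i)) y"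
proof -
  \<comment> \<open>\<open>adjoint\<close> is a Hilbert choice, so its defining identity is
    available only once a witness is known.\<close>
  have "\<exists>f'. \<forall>x y. inner (T x) y = inner x (f' y)"
    using ell2_adjoint_exists[OF assms] by metis
  then have "\<forall>x y. inner (T x) y = inner x (adjoint T y)"
    unfolding adjoint_def by (rule someI_ex)
  then show ?thesis by simp
qed

section \<open>Minimality in a single coordinate\<close>

lemma infsum_ennreal_remove:
  fixes f :: "'a \<Rightarrow> ennreal"
  shows "(\<Sum>\<^sub>\<infinity>j. f j) = f i + (\<Sum>\<^sub>\<infinity>j\<in>- {i}. f j)"
proof -
  have "infsum f ({i} \<union> - {i}) = infsum f {i} + infsum f (- {i})"
    by (intro infsum_Un_disjoint nonneg_summable_on_complete) auto
  then show ?thesis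
    by (simp add: Compl_partition)
qed

lemma J_fun_minimizer_coordinate:
  fixes T :: "'i ell2 \<Rightarrow> 'k ell2"
  assumes T: "bounded_linear T" "onorm T \<le> 1"
    and min: "\<forall>v. J_fun T g p r u \<le> J_fun T g p r v"
  shows "min (\<bar>ell2_nth u i\<bar> powr p) (r powr p)
    \<le> h\<^sup>2 - 2 * h * ell2_nth (adjoint T (g - T u)) i
      + min (\<bar>ell2_nth u i + h\<bar> powr p) (r powr p)"
proof -
  interpret T: bounded_linear T by fact
  define \<phi> where "\<phi> t = min (\<bar>t\<bar> powr p) (r powr p)" for t
  have \<phi>_nonneg: "0 \<le> \<phi> t" for t
    by (simp add: \<phi>_def)
  define w where "w = ell2_nth (adjoint T (g - T u)) i"
  define v where "v = u + h *\<^sub>R ell2_unit i"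
  define R where "R = (\<Sum>\<^sub>\<infinity>j\<in>- {i}. ennreal (\<phi> (ell2_nth u j)))"
  have v_nth: "ell2_nth v j = (if j = i then ell2_nth u i + h else ell2_nth u j)" for j
    by (simp add: v_def plus_ell2.rep_eq scaleR_ell2.rep_eq ell2_unit.rep_eq)
  have Ju: "J_fun T g p r u = ennreal ((norm (T u - g))\<^sup>2 + \<phi> (ell2_nth u i)) + R"
    using infsum_ennreal_remove[of "\<lambda>j. ennreal (\<phi> (ell2_nth u j))" i] \<phi>_nonneg
    by (simp add: J_fun_def R_def \<phi>_def ennreal_plus add.assoc)
  have "(\<Sum>\<^sub>\<infinity>j\<in>- {i}. ennreal (\<phi> (ell2_nth v j))) = R"
    unfolding R_def by (rule infsum_cong) (simp add: v_nth)
  then have Jv: "J_fun T g p r v = ennreal ((norm (T v - g))\<^sup>2 + \<phi> (ell2_nth u i + h)) + R"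
    using infsum_ennreal_remove[of "\<lambda>j. ennreal (\<phi> (ell2_nth v j))" i] \<phi>_nonneg
    by (simp add: J_fun_def \<phi>_def ennreal_plus add.assoc v_nth)
  \<comment> \<open>The zero vector has finite energy; hence \<open>R\<close> is finite and may be
    cancelled in \<open>ennreal\<close>.\<close>
  have "J_fun T g p r u \<le> J_fun T g p r 0"
    using min by blast
  also have "\<dots> < top"
    by (simp add: J_fun_def zero_ell2.rep_eq)
  finally have "R \<noteq> top"
    unfolding Ju by auto
  then have "(norm (T u - g))\<^sup>2 + \<phi> (ell2_nth u i) \<le> (norm (T v - g))\<^sup>2 + \<phi> (ell2_nth u i + h)"
    using min[rule_format, of v] \<phi>_nonneg unfolding Ju Jv
    by (simp add: ennreal_add_left_cancel_le add.commute[of _ R] del: ennreal_plus)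
  moreover have "(norm (T v - g))\<^sup>2 = (norm (T u - g))\<^sup>2 - 2 * h * w + h\<^sup>2 * (norm (T (ell2_unit i)))\<^sup>2"
  proof -
    define x e where "x = T u - g" and "e = T (ell2_unit i)"
    have Tv: "T v - g = x + h *\<^sub>R e"
      by (simp add: v_def x_def e_def T.add T.scaleR)
    have w: "w = - inner e x"
      by (simp add: w_def ell2_nth_adjoint[OF T(1)] x_def e_def inner_diff_right)
    have "(norm (x + h *\<^sub>R e))\<^sup>2 = (norm x)\<^sup>2 + 2 * h * inner e x + h\<^sup>2 * (norm e)\<^sup>2"
      unfolding power2_norm_eq_inner inner_add_left inner_add_right inner_scaleR_left
        inner_scaleR_right inner_commute[of x e]
      by (simp add: power2_eq_square algebra_simps)
    then show ?thesis
      unfolding Tv w by (simp add: x_def e_def)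
  qed
  moreover have "h\<^sup>2 * (norm (T (ell2_unit i)))\<^sup>2 \<le> h\<^sup>2"
  proof -
    have "norm (T (ell2_unit i)) \<le> 1"
      using onorm[OF T(1), of "ell2_unit i"] T(2) by simp
    then show ?thesis
      by (simp add: mult_left_le power_le_one)
  qed
  ultimately show ?thesis
    unfolding \<phi>_def w_def by linarith
qed

section \<open>The scalar problem\<close>

lemma has_real_derivative_abs_powr:
  fixes a :: real
  assumes "a \<noteq> 0"
  shows "((\<lambda>x. \<bar>x\<bar> powr p) has_real_derivative p * sgn a * \<bar>a\<bar> powr (p - 1)) (at a)"
proof (cases "0 < a")
  case True
  have "((\<lambda>x. x powr p) has_real_derivative p * a powr (p - 1)) (at a)"
    using True by (rule has_real_derivative_powr)
  then have "((\<lambda>x. \<bar>x\<bar> powr p) has_real_derivative p * a powr (p - 1)) (at a)"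
    by (rule has_field_derivative_transform_within_open[of _ _ _ "{0<..}"]) (use True in auto)
  then show ?thesis
    using True by simp
next
  case False
  have "((\<lambda>x. (- x) powr p) has_real_derivative p * (- a) powr (p - 1) * - 1) (at a)"
    using False assms by (auto intro!: derivative_eq_intros)
  then have "((\<lambda>x. \<bar>x\<bar> powr p) has_real_derivative p * (- a) powr (p - 1) * - 1) (at a)"
    by (rule has_field_derivative_transform_within_open[of _ _ _ "{..<0}"]) (use False assms in auto)
  then show ?thesis
    using False assms by simp
qed

lemma powr_minimizer_nonzero:
  fixes a w :: real
  assumes "a \<noteq> 0" and min: "\<And>h. \<bar>a\<bar> powr p \<le> h\<^sup>2 - 2 * h * w + \<bar>a + h\<bar> powr p"
  shows "w = p / 2 * sgn a * \<bar>a\<bar> powr (p - 1)"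
proof -
  let ?f = "\<lambda>t. (t - a)\<^sup>2 - 2 * (t - a) * w + \<bar>t\<bar> powr p"
  have "(?f has_real_derivative - 2 * w + p * sgn a * \<bar>a\<bar> powr (p - 1)) (at a)"
    by (rule derivative_eq_intros has_real_derivative_abs_powr[OF assms(1)] refl | simp)+
  moreover have "\<forall>t. \<bar>a - t\<bar> < 1 \<longrightarrow> ?f a \<le> ?f t"
    using min[of "t - a" for t] by simp
  ultimately have "- 2 * w + p * sgn a * \<bar>a\<bar> powr (p - 1) = 0"
    by (rule DERIV_local_min[OF _ zero_less_one])
  then show ?thesis by simp
qed

text \<open>Test with \<open>h = e * w\<close>, divide by \<open>e\<close> and let \<open>e\<close>
  tend to 0 from the right: \<open>e powr (p - 1)\<close> vanishes because \<open>p > 1\<close>,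
  leaving \<open>2 * w\<^sup>2 \<le> 0\<close>.\<close>

lemma powr_minimizer_zero:
  fixes w :: real
  assumes "1 < p" and min: "\<And>h. 0 \<le> h\<^sup>2 - 2 * h * w + \<bar>h\<bar> powr p"
  shows "w = 0"
proof -
  have "2 * w\<^sup>2 \<le> e * w\<^sup>2 + e powr (p - 1) * \<bar>w\<bar> powr p" if "0 < e" for e
  proof -
    have "e powr p = e * e powr (p - 1)"
      using powr_add[of e 1 "p - 1"] that by simp
    then have "0 \<le> e * (e * w\<^sup>2 - 2 * w\<^sup>2 + e powr (p - 1) * \<bar>w\<bar> powr p)"
      using min[of "e * w"] that
      by (simp add: abs_mult powr_mult power2_eq_square algebra_simps)
    then show ?thesis
      using that by (simp add: zero_le_mult_iff)
  qed
  then have "\<forall>\<^sub>F e in at_right 0. 2 * w\<^sup>2 \<le> e * w\<^sup>2 + e powr (p - 1) * \<bar>w\<bar> powr p"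
    by (intro eventually_at_rightI[of 0 1]) auto
  moreover have "((\<lambda>e. e * w\<^sup>2 + e powr (p - 1) * \<bar>w\<bar> powr p) \<longlongrightarrow> 0 * w\<^sup>2 + 0 powr (p - 1) * \<bar>w\<bar> powr p)
      (at_right 0)"
    using \<open>1 < p\<close> by (intro tendsto_intros tendsto_powr') (auto intro!: eventually_at_rightI[of 0 1])
  ultimately have "2 * w\<^sup>2 \<le> 0 * w\<^sup>2 + 0 powr (p - 1) * \<bar>w\<bar> powr p"
    by (intro tendsto_lowerbound) auto
  then show ?thesis by simp
qed

lemma abs_minimizer_zero:
  fixes w :: real
  assumes "\<And>h. 0 \<le> h\<^sup>2 - 2 * h * w + \<bar>h\<bar>"
  shows "\<bar>w\<bar> \<le> 1 / 2"
proof (rule ccontr)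
  assume *: "\<not> \<bar>w\<bar> \<le> 1 / 2"
  \<comment> \<open>Soft thresholding of \<open>w\<close> at level 1/2: the minimizer of the assumed
    expression, with value \<open>- (h\<^sup>2)\<close>.\<close>
  define h where "h = w - sgn w / 2"
  have "h\<^sup>2 - 2 * h * w + \<bar>h\<bar> = - (h\<^sup>2)"
  proof (cases "0 < w")
    case True
    then have "\<bar>h\<bar> = w - 1 / 2" "h = w - 1 / 2"
      using * by (auto simp: h_def)
    then show ?thesis by (simp only:) (simp add: power2_eq_square algebra_simps)
  next
    case False
    then have "\<bar>h\<bar> = - w - 1 / 2" "h = w + 1 / 2"
      using * by (auto simp: h_def sgn_if)
    then show ?thesis by (simp only:) (simp add: power2_eq_square algebra_simps)
  qed
  then have "h\<^sup>2 \<le> 0"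
    using assms[of h] by linarith
  moreover have "h \<noteq> 0"
    using * by (cases "0 < w") (auto simp: h_def)
  ultimately show False by simp
qed

section \<open>The map \<open>F_thr\<close> and the threshold \<open>lambda'\<close>\<close>

lemma F_thr_minus: "F_thr p (- t) = - F_thr p t"
  by (simp add: F_thr_def sgn_minus)

text \<open>Oddness reduces the claim to the nonnegative half-line.\<close>

lemma F_thr_strict_mono:
  assumes "1 < p"
  shows "strict_mono (F_thr p)"
proof -
  have pos: "F_thr p a < F_thr p b" if "0 \<le> a" "a < b" for a b
    using assms that powr_less_mono2[of "p - 1" a b]
    by (cases "a = 0") (auto simp: F_thr_def intro!: add_strict_mono mult_strict_left_mono add_pos_nonneg)
  show ?thesis
  proof (rule strict_monoI)
    fix a b :: real assume "a < b"
    consider "0 \<le> a" | "a < 0" "0 < b" | "b \<le> 0" by linarith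
    then show "F_thr p a < F_thr p b"
    proof cases
      case 1 then show ?thesis using pos \<open>a < b\<close> by blast
    next
      case 2
      then show ?thesis
        using pos[of 0 b] pos[of 0 "- a"] by (simp add: F_thr_minus) (simp add: F_thr_def)
    next
      case 3
      then show ?thesis
        using pos[of "- b" "- a"] \<open>a < b\<close> by (simp add: F_thr_minus)
    qed
  qed
qed

lemma F_inv_F_thr: "1 < p \<Longrightarrow> F_inv p (F_thr p t) = t"
  unfolding F_inv_def by (intro inv_f_f strict_mono_imp_inj_on F_thr_strict_mono)

lemma continuous_on_powr_nonneg:
  assumes "0 < q" "0 \<le> (a :: real)"
  shows "continuous_on {a..b} (\<lambda>s. s powr q)"
  using assms by (intro continuous_on_powr') auto

lemma F_thr_onto_pos:
  assumes "1 < p" "0 < l"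
  obtains s where "0 < s" "F_thr p s = l"
proof -
  \<comment> \<open>Without \<open>sgn\<close> the formula is a sum of continuous terms, ready for
    the intermediate value theorem on \<open>{0..l}\<close>.\<close>
  have F: "F_thr p t = t + p / 2 * t powr (p - 1)" if "0 \<le> t" for t
    using that by (cases "t = 0") (auto simp: F_thr_def)
  have "\<exists>s\<ge>0. s \<le> l \<and> s + p / 2 * s powr (p - 1) = l"
    using assms continuous_on_powr_nonneg[of "p - 1" 0 l]
    by (intro IVT') (auto intro!: continuous_on_add continuous_on_mult continuous_on_divide)
  then obtain s where s: "0 \<le> s" "s + p / 2 * s powr (p - 1) = l" by blast
  then have "s \<noteq> 0"
    using assms by auto
  with s F[of s] that[of s] show ?thesis by simp
qed

text \<open>The minimum over \<open>t\<close> of \<open>(t - F_thr p s)\<^sup>2 + \<bar>t\<bar> powr p\<close>, attained at \<open>t = s\<close>, as a function of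
  the minimizer \<open>s \<ge> 0\<close>.\<close>

definition G_thr :: "real \<Rightarrow> real \<Rightarrow> real"
  where "G_thr p s = (p / 2 * s powr (p - 1))\<^sup>2 + s powr p"

lemma G_thr_less:
  assumes "1 < p" "0 \<le> a" "a < b"
  shows "G_thr p a < G_thr p b"
  unfolding G_thr_def using assms
  by (intro add_strict_mono power_strict_mono mult_strict_left_mono powr_less_mono2) auto

lemma F_thr_G_thr: "0 < s \<Longrightarrow> (s - F_thr p s)\<^sup>2 + \<bar>s\<bar> powr p = G_thr p s"
  by (simp add: F_thr_def G_thr_def)

text \<open>Substituting \<open>l = F_thr p s\<close> turns the defining equation of
  \<open>lambda'\<close> into \<open>G_thr p s = r powr p\<close>. Continuity gives a root and
  strict monotonicity makes it unique, which justifies the definite description.\<close>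

lemma lambda'_eq_F_thr:
  assumes p: "1 < p" and r: "0 < r"
  obtains s where "0 < s" "lambda' r p = F_thr p s" "G_thr p s = r powr p"
proof -
  \<comment> \<open>\<open>G_thr p\<close> is 0 at 0 and at least \<open>r powr p\<close> at
    \<open>r\<close>.\<close>
  have "\<exists>s\<ge>0. s \<le> r \<and> G_thr p s = r powr p"
    using p r continuous_on_powr_nonneg[of "p - 1" 0 r] continuous_on_powr_nonneg[of p 0 r]
    unfolding G_thr_def
    by (intro IVT') (auto intro!: continuous_on_add continuous_on_mult continuous_on_divide
        continuous_on_power)
  then obtain s where s: "0 \<le> s" "G_thr p s = r powr p" by blast
  have "s \<noteq> 0"
    using s r p by (auto simp: G_thr_def)
  with s have "0 < s" by simp
  have F_pos: "0 < F_thr p s"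
    using strict_monoD[OF F_thr_strict_mono[OF p] \<open>0 < s\<close>] by (simp add: F_thr_def)
  have "lambda' r p = (THE l. 0 < l \<and> (F_inv p l - l)\<^sup>2 + \<bar>F_inv p l\<bar> powr p = r powr p)"
    using p by (simp add: lambda'_def)
  also have "\<dots> = F_thr p s"
  proof (rule the_equality)
    show "0 < F_thr p s \<and> (F_inv p (F_thr p s) - F_thr p s)\<^sup>2 + \<bar>F_inv p (F_thr p s)\<bar> powr p = r powr p"
      using F_pos s \<open>0 < s\<close> p F_thr_G_thr[of s p] by (simp add: F_inv_F_thr)
  next
    fix l assume l: "0 < l \<and> (F_inv p l - l)\<^sup>2 + \<bar>F_inv p l\<bar> powr p = r powr p"
    then obtain t where t: "0 < t" "F_thr p t = l"
      using F_thr_onto_pos[OF p] by blast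
    with l p have "G_thr p t = G_thr p s"
      using F_thr_G_thr[of t p] s(2) by (auto simp: F_inv_F_thr)
    then have "t = s"
      using G_thr_less[OF p, of s t] G_thr_less[OF p, of t s] t(1) \<open>0 < s\<close> by (metis less_le linorder_neq_iff)
    then show "l = F_thr p s" using t by simp
  qed
  finally show ?thesis
    using that \<open>0 < s\<close> s(2) by blast
qed

section \<open>Minimizers of the truncated scalar function\<close>

text \<open>Here \<open>a\<close> stands for \<open>u\<^sub>i\<close> and \<open>w\<close> for \<open>[T\<^sup>* (g - T u)]\<^sub>i\<close>; substituting \<open>h = t - a\<close>, the
  assumption says that \<open>a\<close> minimizes \<open>(t - (a + w))\<^sup>2 + min (\<bar>t\<bar> powr p) (r powr p)\<close>.\<close>

locale truncated_minimizer =
  fixes p r a w :: real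
  assumes p: "1 \<le> p" and r: "0 < r"
    and min: "min (\<bar>a\<bar> powr p) (r powr p) \<le> h\<^sup>2 - 2 * h * w + min (\<bar>a + h\<bar> powr p) (r powr p)"
begin

lemma phi_large: "r \<le> \<bar>t\<bar> \<Longrightarrow> min (\<bar>t\<bar> powr p) (r powr p) = r powr p"
  using p r by (auto intro!: min_absorb2 powr_mono2)

lemma phi_small: "\<bar>t\<bar> \<le> r \<Longrightarrow> min (\<bar>t\<bar> powr p) (r powr p) = \<bar>t\<bar> powr p"
  using p r by (auto intro!: min_absorb1 powr_mono2)

text \<open>The competitor \<open>h = w\<close> lowers the quadratic part by
  \<open>w\<^sup>2\<close>, while its penalty is at most \<open>r powr p\<close>, the penalty at
  \<open>a\<close>.\<close>

lemma residual_large: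
  assumes "r < \<bar>a\<bar>"
  shows "w = 0"
  using min[of w] phi_large[of a] assms by (simp add: power2_eq_square) (smt (verit) zero_le_square mult_eq_0_iff)

text \<open>Dropping the truncation only raises the competitors, so there is no kink to treat at
  \<open>\<bar>a\<bar> = r\<close>.\<close>

lemma min_powr:
  assumes "\<bar>a\<bar> \<le> r"
  shows "\<bar>a\<bar> powr p \<le> h\<^sup>2 - 2 * h * w + \<bar>a + h\<bar> powr p"
  using min[of h] phi_small[OF assms] by linarith

lemma residual_small_nonzero: "\<bar>a\<bar> \<le> r \<Longrightarrow> a \<noteq> 0 \<Longrightarrow> w = p / 2 * sgn a * \<bar>a\<bar> powr (p - 1)"
  using powr_minimizer_nonzero min_powr by blast

lemma residual_small:
  assumes "1 < p" "\<bar>a\<bar> \<le> r"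
  shows "w = F_thr p a - a"
proof (cases "a = 0")
  case True
  then have "w = 0"
    using powr_minimizer_zero[OF \<open>1 < p\<close>, of w] min_powr[OF assms(2)] by simp
  then show ?thesis using True by (simp add: F_thr_def)
next
  case False
  then show ?thesis
    using residual_small_nonzero[OF assms(2)] by (simp add: F_thr_def)
qed

lemma residual_small_1:
  assumes "p = 1" "\<bar>a\<bar> \<le> r"
  shows "\<bar>w\<bar> \<le> 1 / 2"
proof (cases "a = 0")
  case True
  then show ?thesis
    using abs_minimizer_zero[of w] min_powr[OF assms(2)] assms(1) by simp
next
  case False
  then show ?thesis
    using residual_small_nonzero[OF assms(2)] assms(1) by (cases "0 < a") auto
qed

text \<open>Since \<open>w = 0\<close> here, \<open>a\<close> has energy exactly
  \<open>r powr p\<close>. The factor \<open>sgn a\<close> reflects the competitor so that only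
  \<open>\<bar>a\<bar>\<close> enters.\<close>

lemma large_competitor:
  assumes "r < \<bar>a\<bar>"
  shows "r powr p \<le> (s - \<bar>a\<bar>)\<^sup>2 + \<bar>s\<bar> powr p"
proof -
  have "r powr p \<le> (sgn a * s - a)\<^sup>2 + min (\<bar>sgn a * s\<bar> powr p) (r powr p)"
    using min[of "sgn a * s - a"] residual_large[OF assms] phi_large[of a] assms by simp
  moreover have "(sgn a * s - a)\<^sup>2 = (s - \<bar>a\<bar>)\<^sup>2" "\<bar>sgn a * s\<bar> = \<bar>s\<bar>"
    using assms r by (cases "0 < a"; simp add: power2_eq_square algebra_simps)+
  ultimately show ?thesis by simp
qed

text \<open>Soft thresholding of \<open>\<bar>a\<bar>\<close> at 1/2 gives a competitor of energy
  \<open>\<bar>a\<bar> - 1 / 4\<close>. If \<open>\<bar>a\<bar> < 1 / 2\<close>, the competitor 0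
  would give \<open>r < 1 / 4\<close>.\<close>

lemma large_ge_lambda'_1:
  assumes "p = 1" "1 / 4 \<le> r" "r < \<bar>a\<bar>"
  shows "r + 1 / 4 \<le> \<bar>a\<bar>"
proof (cases "1 / 2 \<le> \<bar>a\<bar>")
  case True
  then show ?thesis
    using large_competitor[OF assms(3), of "\<bar>a\<bar> - 1 / 2"] assms by (simp add: power2_eq_square)
next
  case False
  have "\<bar>a\<bar> * \<bar>a\<bar> < 1 / 2 * (1 / 2)"
    using False by (intro mult_strict_mono) auto
  then show ?thesis
    using large_competitor[OF assms(3), of 0] assms r by (simp add: power2_eq_square)
qed

lemma large_ge_lambda':
  assumes "1 < p" "r < \<bar>a\<bar>"
  shows "lambda' r p \<le> \<bar>a\<bar>"
proof -
  obtain s' where s': "0 < s'" "lambda' r p = F_thr p s'" "G_thr p s' = r powr p"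
    using lambda'_eq_F_thr[OF assms(1) r] .
  obtain s where s: "0 < s" "F_thr p s = \<bar>a\<bar>"
    using F_thr_onto_pos[OF assms(1), of "\<bar>a\<bar>"] assms r by force
  \<comment> \<open>The competitor \<open>s\<close> is the untruncated minimizer for
    \<open>l = \<bar>a\<bar>\<close>, where the energy is \<open>G_thr p s\<close>.\<close>
  have "G_thr p s' \<le> G_thr p s"
    using large_competitor[OF assms(2), of s] F_thr_G_thr[OF s(1), of p] s s' by simp
  then have "s' \<le> s"
    using G_thr_less[OF assms(1), of s s'] s by force
  then show ?thesis
    using s s' strict_mono_less_eq[OF F_thr_strict_mono[OF assms(1)]] by metis
qed

lemma small_le:
  assumes "1 < p" "\<bar>a\<bar> \<le> r"
  shows "\<bar>a\<bar> \<le> F_inv p (lambda' r p)"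
proof -
  obtain s' where s': "0 < s'" "lambda' r p = F_thr p s'" "G_thr p s' = r powr p"
    using lambda'_eq_F_thr[OF assms(1) r] .
  \<comment> \<open>Moving to \<open>a + w\<close> removes the quadratic cost and leaves a penalty
    of at most \<open>r powr p\<close>; the left side is
    \<open>G_thr p \<bar>a\<bar>\<close>.\<close>
  have "w\<^sup>2 + \<bar>a\<bar> powr p \<le> r powr p"
    using min[of w] phi_small[OF assms(2)] by (simp add: power2_eq_square)
  moreover have "w\<^sup>2 = (p / 2 * \<bar>a\<bar> powr (p - 1))\<^sup>2"
    unfolding residual_small[OF assms]
    by (cases a "0 :: real" rule: linorder_cases) (auto simp: F_thr_def)
  ultimately have "G_thr p \<bar>a\<bar> \<le> G_thr p s'"
    using s' by (simp add: G_thr_def)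
  then have "\<bar>a\<bar> \<le> s'"
    using G_thr_less[OF assms(1), of s' "\<bar>a\<bar>"] s' by force
  then show ?thesis
    using s' F_inv_F_thr[OF assms(1)] by simp
qed

end

text \<open>This is positivity of \<open>delta\<close>: it separates the two ranges of
  \<open>\<bar>u\<^sub>i\<bar>\<close>, so a magnitude in either range determines its side of
  \<open>r\<close>.\<close>

lemma F_inv_lambda'_less:
  assumes "1 < p" "0 < r"
  shows "F_inv p (lambda' r p) < lambda' r p"
proof -
  obtain s where "0 < s" "lambda' r p = F_thr p s"
    using lambda'_eq_F_thr[OF assms] .
  then show ?thesis
    using assms by (simp add: F_inv_F_thr) (simp add: F_thr_def)
qed

theorem theorem4p6p2:
  fixes T :: "'i::countable ell2 \<Rightarrow> 'k::countable ell2"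
    and g :: "'k ell2" and u :: "'i ell2" and p r :: real
  assumes "1 \<le> p" and "p \<le> 2 \<or> finite (UNIV :: 'i set)"
    and "0 < r" and "p = 1 \<longrightarrow> 1 / 4 \<le> r"
    and "bounded_linear T" and "onorm T < 1"
    and "\<forall>v. J_fun T g p r u \<le> J_fun T g p r v"
  shows "(\<forall>i. \<bar>ell2_nth u i\<bar> > r \<longrightarrow> \<bar>ell2_nth u i\<bar> \<ge> lambda' r p)
    \<and> (p > 1 \<longrightarrow> (\<forall>i. \<bar>ell2_nth u i\<bar> \<le> r \<longrightarrow> \<bar>ell2_nth u i\<bar> \<le> F_inv p (lambda' r p)))
    \<and> (p > 1 \<longrightarrow> (\<forall>i.
          (\<bar>ell2_nth u i\<bar> \<ge> lambda' r p \<longrightarrow> ell2_nth (adjoint T (g - T u)) i = 0)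
        \<and> (\<bar>ell2_nth u i\<bar> \<le> lambda' r p - delta r p \<longrightarrow>
            ell2_nth (adjoint T (g - T u)) i = F_thr p (ell2_nth u i) - ell2_nth u i)))
    \<and> (p = 1 \<longrightarrow> (\<forall>i.
          (\<bar>ell2_nth u i\<bar> \<le> 1 / 2 \<longrightarrow> ell2_nth (adjoint T (g - T u)) i \<in> {- 1 / 2 .. 1 / 2})
        \<and> (1 / 2 < \<bar>ell2_nth u i\<bar> \<and> \<bar>ell2_nth u i\<bar> \<le> r - 1 / 4 \<longrightarrow>
            ell2_nth (adjoint T (g - T u)) i = 1 / 2 * sgn (ell2_nth u i))
        \<and> (\<bar>ell2_nth u i\<bar> > r + 1 / 4 \<longrightarrow> ell2_nth (adjoint T (g - T u)) i = 0)))"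
proof -
  define w where "w = ell2_nth (adjoint T (g - T u))"
  have tm: "truncated_minimizer p r (ell2_nth u i) (w i)" for i
    using assms J_fun_minimizer_coordinate[of T g p r u i] unfolding w_def
    by unfold_locales auto
  note large_w = truncated_minimizer.residual_large[OF tm]
  note small_w1 = truncated_minimizer.residual_small_1[OF tm]
  note small_w1' = truncated_minimizer.residual_small_nonzero[OF tm]
  have gt: "p > 1 \<or> p = 1"
    using assms(1) by auto
  have large: "lambda' r p \<le> \<bar>ell2_nth u i\<bar>" if "r < \<bar>ell2_nth u i\<bar>" for i
    using gt truncated_minimizer.large_ge_lambda'[OF tm _ that]
      truncated_minimizer.large_ge_lambda'_1[OF tm _ _ that] assms(4)
    by (auto simp: lambda'_def)
  have small: "\<bar>ell2_nth u i\<bar> \<le> F_inv p (lambda' r p)" if "1 < p" "\<bar>ell2_nth u i\<bar> \<le> r" for i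
    using truncated_minimizer.small_le[OF tm that] .
  \<comment> \<open>A magnitude of at least \<open>lambda'\<close> exceeds the bound in
    \<open>small\<close>, so it must lie above \<open>r\<close>.\<close>
  have A: "w i = 0" if "1 < p" "lambda' r p \<le> \<bar>ell2_nth u i\<bar>" for i
    using small[of i] large_w[of i] F_inv_lambda'_less[of p r] that assms(3) by force
  have B: "w i = F_thr p (ell2_nth u i) - ell2_nth u i"
    if "1 < p" "\<bar>ell2_nth u i\<bar> \<le> lambda' r p - delta r p" for i
  proof (rule truncated_minimizer.residual_small[OF tm \<open>1 < p\<close>])
    show "\<bar>ell2_nth u i\<bar> \<le> r"
      \<comment> \<open>As \<open>lambda' r p - delta r p\<close> is
        \<open>F_inv p (lambda' r p)\<close>, a magnitude above \<open>r\<close> would contradict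
        \<open>large\<close>.\<close>
      using large[of i] that F_inv_lambda'_less[of p r] assms(3) by (force simp: delta_def)
  qed
  \<comment> \<open>For \<open>p = 1\<close> this bound holds at every coordinate: above
    \<open>r\<close> the residual is 0.\<close>
  have C: "w i \<in> {- 1 / 2 .. 1 / 2}" if "p = 1" for i
    using small_w1[OF that, of i] large_w[of i] by (cases "\<bar>ell2_nth u i\<bar> \<le> r") auto
  have D: "w i = 1 / 2 * sgn (ell2_nth u i)"
    if "p = 1" "1 / 2 < \<bar>ell2_nth u i\<bar>" "\<bar>ell2_nth u i\<bar> \<le> r - 1 / 4" for i
    using small_w1'[of i] that by simp
  have E: "w i = 0" if "\<bar>ell2_nth u i\<bar> > r + 1 / 4" for i
    using large_w[of i] that by simp
  show ?thesis
    unfolding w_def[symmetric] using large small A B C D E by blast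
qed

end
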